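(* Let $m\ge 2$ and let $n_1\ge n_2\ge\cdots\ge n_m\ge 0$ be integers with $n_1+n_2+\cdots+n_m\ge 1$. If $m=2$ and $n_2=0$, then $\chi_{la}(K(2;n_1,0))=n_1+2$. Otherwise, $\chi_{la}(K(m;n_1,n_2,\ldots,n_m))\le n_1+n_2+\cdots+n_m+m$, and equality holds if and only if $$\frac{(n_m+m-1)(n_m+m)}{2}>n_1+n_2+\cdots+n_m+\binom{m}{2}.$$
   Context: A local antimagic labeling of a connected graph $G=(V,E)$ is a bijection $f:E\to\{1,\dots,|E|\}$ such that, with $f^+(u)=\sum f(e)$ (sum over all edges $e$ incident to $u$), one has $f^+(u)\neq f^+(v)$ for every pair of adjacent vertices $u,v$. The color number $c(f)$ is the number of distinct values of $f^+$ on $V$. The local antimagic chromatic number $\chi_{la}(G)$ is the minimum of $c(f)$ over all local antimagic labelings $f$ of $G$. $K(m;n_1,\ldots,n_m)$ is the graph obtained from the complete graph $K_m$ by joining $n_i$ new pendant (degree-one) vertices to the $i$-th vertex of $K_m$, for each $1\le i\le m$; it has $n_1+\cdots+n_m+m$ vertices. *)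

theory Defs
  imports Complex_Main "HOL-Library.Extended_Nat"
begin

text \<open>A graph is a vertex set with a set of edges, each edge being the set of its two endpoints.\<close>

definition connected_graph :: "'a set \<Rightarrow> 'a set set \<Rightarrow> bool" where
  "connected_graph V E \<longleftrightarrow>
     finite V \<and> V \<noteq> {} \<and> (\<forall>e\<in>E. e \<subseteq> V \<and> card e = 2) \<and>
     (\<forall>u\<in>V. \<forall>v\<in>V. (u, v) \<in> {(x, y). {x, y} \<in> E}\<^sup>*)"

definition vertex_sum :: "'a set set \<Rightarrow> ('a set \<Rightarrow> nat) \<Rightarrow> 'a \<Rightarrow> nat" where
  "vertex_sum E f u = (\<Sum>e\<in>{e \<in> E. u \<in> e}. f e)"

text \<open>The three notions below are meant for pairs with \<^term>\<open>connected_graph V E\<close>; the graphs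
  \<open>K(m; n\<^sub>1, \<dots>, n\<^sub>m)\<close> satisfy this by lemma \<open>connected_graph_K\<close>.\<close>

definition local_antimagic_labeling :: "'a set \<Rightarrow> 'a set set \<Rightarrow> ('a set \<Rightarrow> nat) \<Rightarrow> bool" where
  "local_antimagic_labeling V E f \<longleftrightarrow>
     bij_betw f E {1..card E} \<and>
     (\<forall>u\<in>V. \<forall>v\<in>V. {u, v} \<in> E \<longrightarrow> vertex_sum E f u \<noteq> vertex_sum E f v)"

definition color_number :: "'a set \<Rightarrow> 'a set set \<Rightarrow> ('a set \<Rightarrow> nat) \<Rightarrow> nat" where
  "color_number V E f = card (vertex_sum E f ` V)"

text \<open>The infimum in \<^typ>\<open>enat\<close> of a nonempty set is its minimum. A graph without any local
  antimagic labeling gets the value \<open>\<infinity>\<close>, so a finite bound includes the existence of a labeling.\<close>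

definition chi_la :: "'a set \<Rightarrow> 'a set set \<Rightarrow> enat" where
  "chi_la V E = (INF f\<in>{f. local_antimagic_labeling V E f}. enat (color_number V E f))"

text \<open>\<open>Core i\<close> is the \<open>i\<close>-th vertex of \<open>K\<^sub>m\<close>, and \<open>Pendant i j\<close> is the \<open>j\<close>-th pendant vertex
  joined to it. Indices start at 1; \<open>n i\<close> matters only for \<open>i\<close> in \<open>{1..m}\<close>.\<close>

datatype kvertex = Core nat | Pendant nat nat

definition K_verts :: "nat \<Rightarrow> (nat \<Rightarrow> nat) \<Rightarrow> kvertex set" where
  "K_verts m n = {Core i | i. i \<in> {1..m}} \<union> {Pendant i j | i j. i \<in> {1..m} \<and> j \<in> {1..n i}}"

definition K_edges :: "nat \<Rightarrow> (nat \<Rightarrow> nat) \<Rightarrow> kvertex set set" where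
  "K_edges m n =
     {{Core i, Core j} | i j. i \<in> {1..m} \<and> j \<in> {1..m} \<and> i \<noteq> j} \<union>
     {{Core i, Pendant i j} | i j. i \<in> {1..m} \<and> j \<in> {1..n i}}"

lemma K_verts_eq:
  "K_verts m n = Core ` {1..m} \<union> (\<lambda>(i, j). Pendant i j) ` (SIGMA i:{1..m}. {1..n i})"
  by (auto simp: K_verts_def)

lemma card_K_verts: "card (K_verts m n) = (\<Sum>i=1..m. n i) + m"
proof -
  have "card (Core ` {1..m}) = m"
    by (subst card_image) (auto simp: inj_on_def)
  moreover have "card ((\<lambda>(i, j). Pendant i j) ` (SIGMA i:{1..m}. {1..n i})) = (\<Sum>i=1..m. n i)"
    by (subst card_image) (auto simp: inj_on_def)
  ultimately show ?thesis
    unfolding K_verts_eq by (subst card_Un_disjoint) auto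
qed

lemma connected_graph_K:
  assumes "m \<ge> 1"
  shows "connected_graph (K_verts m n) (K_edges m n)"
proof -
  let ?r = "{(x, y). {x, y} \<in> K_edges m n}"
  have fin: "finite (K_verts m n)"
    unfolding K_verts_eq by auto
  have ne: "K_verts m n \<noteq> {}"
    using assms by (auto simp: K_verts_def)
  have edges: "\<forall>e\<in>K_edges m n. e \<subseteq> K_verts m n \<and> card e = 2"
    by (auto simp: K_edges_def K_verts_def card_insert_if)
  have sym: "sym ?r"
    by (auto simp: sym_def insert_commute)
  have core: "(Core i, Core 1) \<in> ?r\<^sup>*" if "i \<in> {1..m}" for i
  proof (cases "i = 1")
    case False
    have "{Core i, Core 1} \<in> K_edges m n"
      unfolding K_edges_def using that assms False by fastforce
    then show ?thesis by auto
  qed auto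
  have to1: "(v, Core 1) \<in> ?r\<^sup>*" if v: "v \<in> K_verts m n" for v
  proof (cases v)
    case (Core i)
    then show ?thesis using v core by (auto simp: K_verts_def)
  next
    case (Pendant i j)
    with v have i: "i \<in> {1..m}" and j: "j \<in> {1..n i}" by (auto simp: K_verts_def)
    then have "{Core i, Pendant i j} \<in> K_edges m n"
      unfolding K_edges_def by blast
    then have "(v, Core i) \<in> ?r"
      using Pendant by (simp add: insert_commute)
    then show ?thesis using core[OF i] by (rule converse_rtrancl_into_rtrancl)
  qed
  have "(u, v) \<in> ?r\<^sup>*" if "u \<in> K_verts m n" "v \<in> K_verts m n" for u v
    using to1[OF that(1)] to1[OF that(2)] sym_rtrancl[OF sym]
    by (meson rtrancl_trans symD)
  then show ?thesis
    unfolding connected_graph_def using fin ne edges by blast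
qed

end

theory Submission
  imports Defs "HOL-Library.Infinite_Set" "HOL-Library.Nat_Bijection"
begin

text \<open>Let \<open>d = n\<^sub>m + m - 1\<close> be the minimum degree of a core vertex and \<open>T = 1 + \<dots> + d\<close>. Every core sum
  is at least \<open>T\<close>, so if \<open>T\<close> exceeds the number of edges, core sums avoid all pendant labels and
  every local antimagic labeling has pairwise distinct vertex sums. Otherwise give the edges at
  core \<open>m\<close> the labels \<open>1, \<dots>, d\<close>, so that its sum is \<open>T\<close>, and give the label \<open>T\<close> to a pendant edge
  at another core. The remaining labels are split arbitrarily between the other pendant edges and
  the other core edges; within each of the three classes, edges are labeled in an order that
  favours cores of smaller index. The sums of two cores can then be compared label by label, so
  core sums are distinct.\<close>

section \<open>The edges at a vertex\<close>

lemma finite_K_verts: "finite (K_verts m n)"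
  unfolding K_verts_eq by auto

lemma finite_K_edges: "finite (K_edges m n)"
proof -
  have "K_edges m n \<subseteq> Pow (K_verts m n)"
    by (auto simp: K_edges_def K_verts_def)
  then show ?thesis
    using finite_K_verts finite_Pow_iff finite_subset by metis
qed

lemma Core_edge_in: "i \<in> {1..m} \<Longrightarrow> j \<in> {1..m} \<Longrightarrow> i \<noteq> j \<Longrightarrow> {Core i, Core j} \<in> K_edges m n"
  unfolding K_edges_def by blast

lemma Pendant_edge_in: "i \<in> {1..m} \<Longrightarrow> j \<in> {1..n i} \<Longrightarrow> {Core i, Pendant i j} \<in> K_edges m n"
  unfolding K_edges_def by blast

lemma card_K_edges: "card (K_edges m n) = (\<Sum>i=1..m. n i) + (m choose 2)"
proof -
  have "{{Core i, Core j} | i j. i \<in> {1..m} \<and> j \<in> {1..m} \<and> i \<noteq> j}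
      = {e. e \<subseteq> Core ` {1..m} \<and> card e = 2}"
    by (auto simp: card_2_iff)
  moreover have "card (Core ` {1..m}) = m"
    by (subst card_image) (auto simp: inj_on_def)
  ultimately have A: "card {{Core i, Core j} | i j. i \<in> {1..m} \<and> j \<in> {1..m} \<and> i \<noteq> j} = m choose 2"
    "finite {{Core i, Core j} | i j. i \<in> {1..m} \<and> j \<in> {1..m} \<and> i \<noteq> j}"
    using n_subsets[of "Core ` {1..m}" 2] by auto
  have "{{Core i, Pendant i j} | i j. i \<in> {1..m} \<and> j \<in> {1..n i}}
      = (\<lambda>(i, j). {Core i, Pendant i j}) ` (SIGMA i:{1..m}. {1..n i})"
    by (auto simp: image_iff) blast
  moreover have "inj_on (\<lambda>(i, j). {Core i, Pendant i j}) (SIGMA i:{1..m}. {1..n i})"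
    by (auto simp: inj_on_def doubleton_eq_iff)
  ultimately have B: "card {{Core i, Pendant i j} | i j. i \<in> {1..m} \<and> j \<in> {1..n i}} = (\<Sum>i=1..m. n i)"
    "finite {{Core i, Pendant i j} | i j. i \<in> {1..m} \<and> j \<in> {1..n i}}"
    by (auto simp: card_image)
  show ?thesis
    unfolding K_edges_def using A B by (subst card_Un_disjoint) (auto simp: doubleton_eq_iff)
qed

lemma edges_at_Core:
  assumes "i \<in> {1..m}"
  shows "{e \<in> K_edges m n. Core i \<in> e}
    = (\<lambda>c. {Core i, Core c}) ` ({1..m} - {i}) \<union> (\<lambda>j. {Core i, Pendant i j}) ` {1..n i}"
  using assms by (auto simp: K_edges_def insert_commute)

lemma vertex_sum_Core:
  assumes "i \<in> {1..m}"
  shows "vertex_sum (K_edges m n) f (Core i)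
    = (\<Sum>c\<in>{1..m} - {i}. f {Core i, Core c}) + (\<Sum>j=1..n i. f {Core i, Pendant i j})"
proof -
  have "inj_on (\<lambda>c. {Core i, Core c}) ({1..m} - {i})" "inj_on (\<lambda>j. {Core i, Pendant i j}) {1..n i}"
    by (auto simp: inj_on_def doubleton_eq_iff)
  then show ?thesis
    unfolding vertex_sum_def edges_at_Core[OF assms]
    by (subst sum.union_disjoint) (auto simp: sum.reindex doubleton_eq_iff)
qed

lemma card_edges_at_Core:
  assumes "i \<in> {1..m}"
  shows "card {e \<in> K_edges m n. Core i \<in> e} = n i + m - 1"
  \<comment> \<open>The degree is the vertex sum under the constant labeling 1.\<close>
  using vertex_sum_Core[OF assms, of n "\<lambda>_. 1"] assms by (simp add: vertex_sum_def)

lemma vertex_sum_Pendant: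
  assumes "i \<in> {1..m}" "j \<in> {1..n i}"
  shows "vertex_sum (K_edges m n) f (Pendant i j) = f {Core i, Pendant i j}"
proof -
  have "{e \<in> K_edges m n. Pendant i j \<in> e} = {{Core i, Pendant i j}}"
    using assms by (auto simp: K_edges_def)
  then show ?thesis
    by (simp add: vertex_sum_def)
qed

lemma label_less_vertex_sum:
  assumes "finite E" "e \<in> E" "e' \<in> E" "e \<noteq> e'" "u \<in> e" "u \<in> e'" "f e' > 0"
  shows "f e < vertex_sum E f u"
proof -
  have "f e < sum f {e, e'}"
    using assms by simp
  also have "\<dots> \<le> vertex_sum E f u"
    unfolding vertex_sum_def using assms by (intro sum_mono2) auto
  finally show ?thesis .
qed

text \<open>With positive labels the adjacency condition is automatic on pendant edges: since
  \<open>m >= 2\<close>, the core end has a further edge, to another core.\<close>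

lemma Pendant_less_Core:
  assumes "m \<ge> 2" "i \<in> {1..m}" "j \<in> {1..n i}"
    and pos: "\<And>e. e \<in> K_edges m n \<Longrightarrow> f e > 0"
  shows "vertex_sum (K_edges m n) f (Pendant i j) < vertex_sum (K_edges m n) f (Core i)"
proof -
  obtain c where c: "c \<in> {1..m}" "c \<noteq> i"
    using assms(1) by (cases "i = 1") (auto intro: that[of 1] that[of 2])
  show ?thesis
    unfolding vertex_sum_Pendant[of i m j n f, OF assms(2,3)]
    using assms c
    by (intro label_less_vertex_sum[where e' = "{Core i, Core c}"])
      (auto intro!: finite_K_edges Core_edge_in Pendant_edge_in pos simp: doubleton_eq_iff)
qed

text \<open>Both sums contain the label of the edge joining the two vertices, so that edge is left out of
  the comparison.\<close>

lemma vertex_sum_Core_less: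
  assumes ab: "a \<in> {1..m}" "b \<in> {1..m}" "a \<noteq> b" "n b \<le> n a"
    and core: "\<And>c. c \<in> {1..m} - {a, b} \<Longrightarrow> f {Core b, Core c} < f {Core a, Core c}"
    and pend: "\<And>j. j \<in> {1..n b} \<Longrightarrow> f {Core b, Pendant b j} < f {Core a, Pendant a j}"
    and nontrivial: "m \<ge> 3 \<or> n b \<ge> 1"
  shows "vertex_sum (K_edges m n) f (Core b) < vertex_sum (K_edges m n) f (Core a)"
proof -
  let ?R = "{1..m} - {a, b}"
  have split: "(\<Sum>c\<in>{1..m} - {x}. f {Core x, Core c})
      = f {Core a, Core b} + (\<Sum>c\<in>?R. f {Core x, Core c})"
    if "x = a \<and> y = b \<or> x = b \<and> y = a" for x y
  proof -
    have "{1..m} - {x} = insert y ?R" "y \<notin> ?R" "{Core x, Core y} = {Core a, Core b}"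
      using that ab by auto
    then show ?thesis
      by simp
  qed
  have core_le: "(\<Sum>c\<in>?R. f {Core b, Core c}) \<le> (\<Sum>c\<in>?R. f {Core a, Core c})"
    using core by (intro sum_mono) (auto intro: less_imp_le)
  have pend_le: "(\<Sum>j=1..n b. f {Core b, Pendant b j}) \<le> (\<Sum>j=1..n b. f {Core a, Pendant a j})"
    using pend by (intro sum_mono) (auto intro: less_imp_le)
  have more: "(\<Sum>j=1..n b. f {Core a, Pendant a j}) \<le> (\<Sum>j=1..n a. f {Core a, Pendant a j})"
    using ab by (intro sum_mono2) auto
  \<comment> \<open>Strictness must come from at least one compared pair of edges: a third core
    supplies one when \<open>m >= 3\<close>, a pendant vertex at \<open>b\<close> supplies one when
    \<open>n b >= 1\<close>.\<close>
  have "(\<Sum>c\<in>?R. f {Core b, Core c}) < (\<Sum>c\<in>?R. f {Core a, Core c})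
      \<or> (\<Sum>j=1..n b. f {Core b, Pendant b j}) < (\<Sum>j=1..n b. f {Core a, Pendant a j})"
    using nontrivial
  proof
    assume "m \<ge> 3"
    then have "card ?R > 0"
      using ab by (subst card_Diff_subset) auto
    then have "?R \<noteq> {}"
      by (metis card.empty less_irrefl)
    then show ?thesis
      using core by (intro disjI1 sum_strict_mono) auto
  next
    assume "n b \<ge> 1"
    then show ?thesis
      using pend by (intro disjI2 sum_strict_mono) auto
  qed
  then show ?thesis
    unfolding vertex_sum_Core[OF ab(1)] vertex_sum_Core[OF ab(2)]
    using split[of a b] split[of b a] core_le pend_le more by linarith
qed

section \<open>Injective vertex sums\<close>

lemma sum_ge_triangular:
  fixes X :: "nat set"
  assumes "finite X" "0 \<notin> X"
  shows "\<Sum>{1..card X} \<le> \<Sum>X"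
proof -
  \<comment> \<open>The bound for naturals compares with a segment starting at 0. Adding 0 to
    \<open>X\<close> keeps its sum and lengthens that segment by one, up to
    \<open>card X\<close>.\<close>
  have "\<Sum>{0..<card (insert 0 X)} \<le> \<Sum>(insert 0 X)"
    using assms by (intro card_sum_le_nat_sum)
  moreover have "{0..<card (insert 0 X)} = insert 0 {1..card X}"
    using assms by auto
  ultimately show ?thesis
    using assms by (simp del: sum.op_ivl_Suc)
qed

text \<open>The labels at \<open>u\<close> are at least \<open>d\<close> distinct positive
  integers.\<close>

lemma triangular_le_vertex_sum:
  assumes "finite E" "inj_on f E" "\<And>e. e \<in> E \<Longrightarrow> f e > 0" "d \<le> card {e \<in> E. u \<in> e}"
  shows "\<Sum>{1..d} \<le> vertex_sum E f u"
proof -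
  let ?D = "{e \<in> E. u \<in> e}"
  have inj: "inj_on f ?D"
    using assms(2) by (rule inj_on_subset) auto
  have "\<Sum>{1..d} \<le> \<Sum>{1..card (f ` ?D)}"
    using assms(4) inj by (intro sum_mono2) (auto simp: card_image)
  also have "\<dots> \<le> \<Sum>(f ` ?D)"
    using assms(1) assms(3) by (intro sum_ge_triangular) force+
  also have "\<dots> = vertex_sum E f u"
    unfolding vertex_sum_def by (subst sum.reindex[OF inj]) simp
  finally show ?thesis .
qed

lemma color_number_le_card:
  "color_number (K_verts m n) (K_edges m n) f \<le> (\<Sum>i=1..m. n i) + m"
  unfolding color_number_def card_K_verts[symmetric] by (intro card_image_le finite_K_verts)

text \<open>Adjacency separates the cores from each other, and injectivity of \<open>f\<close>
  separates the pendant vertices, whose sums are single labels. Only a core and a pendant vertex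
  could share a color.\<close>

lemma color_number_maximal:
  assumes f: "local_antimagic_labeling (K_verts m n) (K_edges m n) f"
    and cp: "\<And>k i j. k \<in> {1..m} \<Longrightarrow> i \<in> {1..m} \<Longrightarrow> j \<in> {1..n i} \<Longrightarrow>
      vertex_sum (K_edges m n) f (Core k) \<noteq> vertex_sum (K_edges m n) f (Pendant i j)"
  shows "color_number (K_verts m n) (K_edges m n) f = (\<Sum>i=1..m. n i) + m"
proof -
  let ?w = "vertex_sum (K_edges m n) f"
  have bij: "bij_betw f (K_edges m n) {1..card (K_edges m n)}"
    and adj: "\<And>u v. u \<in> K_verts m n \<Longrightarrow> v \<in> K_verts m n \<Longrightarrow> {u, v} \<in> K_edges m n \<Longrightarrow> ?w u \<noteq> ?w v"
    using f by (auto simp: local_antimagic_labeling_def)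
  have core: "?w (Core i) \<noteq> ?w (Core k)" if "i \<in> {1..m}" "k \<in> {1..m}" "i \<noteq> k" for i k
    using that by (intro adj Core_edge_in) (auto simp: K_verts_def)
  have pend: "i = i' \<and> j = j'"
    if "i \<in> {1..m}" "j \<in> {1..n i}" "i' \<in> {1..m}" "j' \<in> {1..n i'}"
      "?w (Pendant i j) = ?w (Pendant i' j')" for i j i' j'
  proof -
    have "f {Core i, Pendant i j} = f {Core i', Pendant i' j'}"
      using that by (simp add: vertex_sum_Pendant)
    then have "{Core i, Pendant i j} = {Core i', Pendant i' j'}"
      using bij that Pendant_edge_in[of i m j n] Pendant_edge_in[of i' m j' n]
      unfolding bij_betw_def inj_on_def by blast
    then show ?thesis
      by (auto simp: doubleton_eq_iff)
  qed
  have "inj_on ?w (K_verts m n)"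
  proof (rule inj_onI)
    fix u v assume u: "u \<in> K_verts m n" and v: "v \<in> K_verts m n" and eq: "?w u = ?w v"
    show "u = v"
    proof (cases u; cases v)
      fix i k assume "u = Core i" "v = Core k"
      with u v eq core[of i k] show ?thesis by (auto simp: K_verts_def)
    next
      fix k i j assume "u = Core k" "v = Pendant i j"
      with u v eq cp[of k i j] show ?thesis by (auto simp: K_verts_def)
    next
      fix i j k assume "u = Pendant i j" "v = Core k"
      with u v eq cp[of k i j] show ?thesis by (auto simp: K_verts_def)
    next
      fix i j i' j' assume "u = Pendant i j" "v = Pendant i' j'"
      with u v eq pend[of i j i' j'] show ?thesis by (auto simp: K_verts_def)
    qed
  qed
  then show ?thesis
    unfolding color_number_def card_K_verts[symmetric] by (rule card_image)
qed

lemma color_number_eq_of_large_degrees: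
  assumes f: "local_antimagic_labeling (K_verts m n) (K_edges m n) f"
    and min: "\<And>i. i \<in> {1..m} \<Longrightarrow> n m \<le> n i"
    and large: "card (K_edges m n) < \<Sum>{1..n m + m - 1}"
  shows "color_number (K_verts m n) (K_edges m n) f = (\<Sum>i=1..m. n i) + m"
proof (rule color_number_maximal[OF f])
  let ?E = "K_edges m n"
  fix k i j assume k: "k \<in> {1..m}" and i: "i \<in> {1..m}" and j: "j \<in> {1..n i}"
  have bij: "bij_betw f ?E {1..card ?E}"
    using f by (auto simp: local_antimagic_labeling_def)
  then have rng: "f e > 0 \<and> f e \<le> card ?E" if "e \<in> ?E" for e
    using that by (fastforce dest: bij_betwE)
  have "\<Sum>{1..n m + m - 1} \<le> vertex_sum ?E f (Core k)"
    using bij rng min[OF k] k finite_K_edges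
    by (intro triangular_le_vertex_sum) (auto simp: card_edges_at_Core bij_betw_def)
  moreover have "vertex_sum ?E f (Pendant i j) \<le> card ?E"
    using i j rng[OF Pendant_edge_in] by (simp add: vertex_sum_Pendant)
  ultimately show "vertex_sum ?E f (Core k) \<noteq> vertex_sum ?E f (Pendant i j)"
    using large by linarith
qed

section \<open>The labeling\<close>

text \<open>Each element goes to the member of \<open>S\<close> whose rank in \<open>S\<close>
  equals the rank of its key among all keys.\<close>

lemma ex_monotone_bij_betw:
  fixes k :: "'a \<Rightarrow> nat" and S :: "nat set"
  assumes "finite A" "finite S" "card A = card S" "inj_on k A"
  shows "\<exists>g. bij_betw g A S \<and> (\<forall>x\<in>A. \<forall>y\<in>A. k x < k y \<longrightarrow> g x < g y)"
proof -
  obtain h where h: "bij_betw h {..<card (k ` A)} (k ` A)" "strict_mono_on {..<card (k ` A)} h"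
    using ex_bij_betw_strict_mono_card[of "k ` A"] assms(1) by blast
  obtain h' where h': "bij_betw h' {..<card S} S" "strict_mono_on {..<card S} h'"
    using ex_bij_betw_strict_mono_card[OF assms(2)] by blast
  have c: "card (k ` A) = card S"
    using assms by (simp add: card_image)
  let ?r = "\<lambda>x. inv_into {..<card S} h (k x)"
  have r: "bij_betw ?r A {..<card S}"
    using bij_betw_trans[OF inj_on_imp_bij_betw[OF assms(4)] bij_betw_inv_into[OF h(1)]]
    by (simp add: c comp_def)
  have hr: "h (?r x) = k x" if "x \<in> A" for x
    using bij_betw_inv_into_right[OF h(1), of "k x"] that c by simp
  have "?r x < ?r y" if "x \<in> A" "y \<in> A" "k x < k y" for x y
  proof -
    have "?r x \<in> {..<card (k ` A)}" "?r y \<in> {..<card (k ` A)}"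
      using that(1,2) bij_betwE[OF r] c by simp_all
    then show ?thesis
      using strict_mono_on_less[OF h(2)] hr[OF that(1)] hr[OF that(2)] that(3) by metis
  qed
  then have "\<forall>x\<in>A. \<forall>y\<in>A. k x < k y \<longrightarrow> h' (?r x) < h' (?r y)"
    using h'(2) bij_betwE[OF r] by (meson strict_mono_onD)
  then show ?thesis
    using bij_betw_trans[OF r h'(1)] by (auto simp: comp_def)
qed

text \<open>Vertices at cores of smaller index get larger positions, and the position of \<open>Pendant i j\<close>
  decreases in \<open>i\<close> for fixed \<open>j\<close>. Comparing edges as binary numbers built from the positions of
  their endpoints makes the order on edges injective and monotone in each endpoint.\<close>

definition vertex_pos :: "nat \<Rightarrow> kvertex \<Rightarrow> nat" where
  "vertex_pos m v = (case v of Core i \<Rightarrow> 2 * (m - i) | Pendant i j \<Rightarrow> 2 * (j * m + (m - i)) + 1)"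

definition edge_key :: "nat \<Rightarrow> kvertex set \<Rightarrow> nat" where
  "edge_key m e = set_encode (vertex_pos m ` e)"

lemma inj_on_vertex_pos: "inj_on (vertex_pos m) (K_verts m n)"
proof (rule inj_onI)
  fix u v assume uv: "u \<in> K_verts m n" "v \<in> K_verts m n" "vertex_pos m u = vertex_pos m v"
  \<comment> \<open>For \<open>i\<close> in \<open>{1..m}\<close> the number \<open>m - i\<close> is
    below \<open>m\<close>, so division by \<open>m\<close> recovers \<open>j\<close> as quotient
    and \<open>m - i\<close> as remainder.\<close>
  have eqD: "j = j' \<and> i = i'" if "j * m + m - i = j' * m + m - i'" "i \<in> {1..m}" "i' \<in> {1..m}"
    for i j i' j'
  proof -
    have quot: "(x * m + r) div m = x" if "r < m" for x r
      using that by simp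
    have "(j * m + (m - i)) div m = j" "(j' * m + (m - i')) div m = j'"
      using that(2,3) by (intro quot; auto)+
    with that show ?thesis
      by auto
  qed
  \<comment> \<open>Cores have even positions and pendant vertices odd ones, so the two kinds never
    collide.\<close>
  have parity: "2 * x \<noteq> Suc (2 * y)" "Suc (2 * y) \<noteq> 2 * x" for x y :: nat
    by presburger+
  show "u = v"
    using uv by (cases u; cases v) (auto simp: vertex_pos_def K_verts_def parity dest: eqD)
qed

lemma inj_on_edge_key: "inj_on (edge_key m) (K_edges m n)"
proof (rule inj_onI)
  fix e e' assume e: "e \<in> K_edges m n" "e' \<in> K_edges m n" "edge_key m e = edge_key m e'"
  have sub: "e \<subseteq> K_verts m n" "e' \<subseteq> K_verts m n"
    using e by (auto simp: K_edges_def K_verts_def)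
  then have "finite e" "finite e'"
    using finite_K_verts finite_subset by blast+
  then have "vertex_pos m ` e = vertex_pos m ` e'"
    using e(3) by (simp add: edge_key_def set_encode_eq)
  then show "e = e'"
    using inj_on_image_eq_iff[OF inj_on_vertex_pos sub] by simp
qed

lemma edge_key_doubleton:
  assumes "vertex_pos m u \<noteq> vertex_pos m v"
  shows "edge_key m {u, v} = 2 ^ vertex_pos m u + 2 ^ vertex_pos m v"
  using assms by (simp add: edge_key_def set_encode_def)

text \<open>The power of 2 for the shared endpoint \<open>Core c\<close> occurs in both keys, so the
  positions of the other endpoints decide.\<close>

lemma edge_key_Core_less:
  assumes "a < b" "a \<in> {1..m}" "b \<in> {1..m}" "c \<in> {1..m} - {a, b}"
  shows "edge_key m {Core b, Core c} < edge_key m {Core a, Core c}"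
  using assms by (subst (1 2) edge_key_doubleton) (auto simp: vertex_pos_def)

lemma edge_key_Pendant_less:
  assumes "a < b" "a \<in> {1..m}" "b \<in> {1..m}"
  shows "edge_key m {Core b, Pendant b j} < edge_key m {Core a, Pendant a j}"
proof -
  have parity: "2 * x \<noteq> Suc (2 * y)" "Suc (2 * y) \<noteq> 2 * x" for x y :: nat
    by presburger+
  show ?thesis
    using assms
    by (subst (1 2) edge_key_doubleton) (auto simp: vertex_pos_def parity intro!: add_strict_mono)
qed

text \<open>The label \<open>L\<close> is a parameter because the lemma serves two purposes: a
  suitable \<open>L\<close> makes a pendant vertex collide with core \<open>m\<close>, and any
  admissible \<open>L\<close> shows that a labeling exists. The lower bound on \<open>L\<close>
  keeps it off the labels reserved for core \<open>m\<close>.\<close>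

lemma ex_labeling:
  assumes m: "m \<ge> 2"
    and antimono: "\<And>i j. 1 \<le> i \<Longrightarrow> i \<le> j \<Longrightarrow> j \<le> m \<Longrightarrow> n j \<le> n i"
    and n1: "n 1 \<ge> 1"
    and not_star: "m \<ge> 3 \<or> n m \<ge> 1"
    and L: "n m + m - 1 < L" "L \<le> card (K_edges m n)"
  shows "\<exists>f. local_antimagic_labeling (K_verts m n) (K_edges m n) f \<and>
    vertex_sum (K_edges m n) f (Core m) = \<Sum>{1..n m + m - 1} \<and>
    (\<exists>i\<in>{1..m}. \<exists>j\<in>{1..n i}. f {Core i, Pendant i j} = L)"
proof -
  let ?E = "K_edges m n" and ?k = "edge_key m"
  define d where "d = n m + m - 1"
  \<comment> \<open>\<open>A\<close> includes the pendant edges at core \<open>m\<close>,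
    \<open>B\<close> holds all other pendant edges, and \<open>C\<close> is left with the edges
    among cores other than \<open>m\<close>.\<close>
  define A where "A = {e \<in> ?E. Core m \<in> e}"
  define B where "B = {{Core i, Pendant i j} | i j. i \<in> {1..<m} \<and> j \<in> {1..n i}}"
  define C where "C = ?E - A - B"
  have BE: "B \<subseteq> ?E" and AB: "A \<inter> B = {}"
    by (auto simp: A_def B_def K_edges_def)
  have fin: "finite A" "finite B" "finite C"
    using finite_K_edges[of m n] BE finite_subset by (auto simp: A_def C_def)
  have cA: "card A = d"
    unfolding A_def d_def using m by (intro card_edges_at_Core) auto
  have E: "A \<union> B \<union> C = ?E"
    using BE by (auto simp: A_def C_def)
  have cE: "card ?E = card A + card B + card C"
    unfolding E[symmetric] using fin AB
    by (subst card_Un_disjoint; (subst card_Un_disjoint)?) (auto simp: C_def)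
  \<comment> \<open>Core 1 differs from core \<open>m\<close> and has a pendant vertex, so some edge
    of \<open>B\<close> can take the label \<open>L\<close>.\<close>
  have "{Core 1, Pendant 1 1} \<in> B"
    using m n1 by (force simp: B_def)
  then have cB: "card B \<ge> 1"
    using fin(2) by (metis One_nat_def Suc_leI card_gt_0_iff empty_iff)

  \<comment> \<open>These labels remain after \<open>A\<close> is served, and there are
    \<open>card B + card C\<close> of them. \<open>B\<close> receives \<open>L\<close> and any
    \<open>card B - 1\<close> others.\<close>
  let ?I = "{d<..card ?E}"
  have "card B - 1 \<le> card (?I - {L})"
    using L cE cA by (simp add: d_def)
  then obtain S' where S': "S' \<subseteq> ?I - {L}" "card S' = card B - 1" "finite S'"
    using obtain_subset_with_card_n by metis
  define S where "S = insert L S'"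
  have S: "S \<subseteq> ?I" "card S = card B" "finite S" "L \<in> S"
    using S' L cB by (auto simp: S_def d_def card_insert_if)
  have cR: "card (?I - S) = card C"
    using S cE cA by (simp add: card_Diff_subset)

  have injs: "inj_on ?k A" "inj_on ?k B" "inj_on ?k C"
    using E by (auto intro: inj_on_subset[OF inj_on_edge_key[of m n]])
  obtain f1 where f1: "bij_betw f1 A {1..d}" "\<forall>x\<in>A. \<forall>y\<in>A. ?k x < ?k y \<longrightarrow> f1 x < f1 y"
    using ex_monotone_bij_betw[of A "{1..d}" ?k] fin cA injs by auto
  obtain f2 where f2: "bij_betw f2 B S" "\<forall>x\<in>B. \<forall>y\<in>B. ?k x < ?k y \<longrightarrow> f2 x < f2 y"
    using ex_monotone_bij_betw[of B S ?k] fin S injs by auto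
  obtain f3 where f3: "bij_betw f3 C (?I - S)" "\<forall>x\<in>C. \<forall>y\<in>C. ?k x < ?k y \<longrightarrow> f3 x < f3 y"
    using ex_monotone_bij_betw[of C "?I - S" ?k] fin cR injs by auto
  define f where "f e = (if e \<in> A then f1 e else if e \<in> B then f2 e else f3 e)" for e
  have fA: "bij_betw f A {1..d}"
    using f1(1) by (rule bij_betw_cong[THEN iffD1, rotated]) (simp add: f_def)
  have fB: "bij_betw f B S"
    using f2(1) by (rule bij_betw_cong[THEN iffD1, rotated]) (use AB in \<open>auto simp: f_def\<close>)
  have fC: "bij_betw f C (?I - S)"
    using f3(1) by (rule bij_betw_cong[THEN iffD1, rotated]) (auto simp: f_def C_def)
  have "bij_betw f (A \<union> B \<union> C) ({1..d} \<union> S \<union> (?I - S))"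
    using fA fB fC S(1) by (intro bij_betw_combine) auto
  moreover have "{1..d} \<union> S \<union> (?I - S) = {1..card ?E}"
    using S(1) cE cA by auto
  ultimately have bij: "bij_betw f ?E {1..card ?E}"
    by (simp add: E)
  have pos: "f e > 0" if "e \<in> ?E" for e
    using bij_betwE[OF bij] that by fastforce

  \<comment> \<open>The last two premises put \<open>x\<close> and \<open>y\<close> into the same
    class, where labels follow the order of the keys.\<close>
  have mono: "f x < f y" if "x \<in> ?E" "y \<in> ?E" "?k x < ?k y"
    "Core m \<in> x \<longleftrightarrow> Core m \<in> y" "x \<in> B \<longleftrightarrow> y \<in> B" for x y
    using that f1(2) f2(2) f3(2) by (auto simp: f_def A_def C_def)
  have low: "f x < f y" if "x \<in> ?E" "y \<in> ?E" "Core m \<in> x" "Core m \<notin> y" for x y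
  proof -
    have "x \<in> A" "y \<in> B \<union> C"
      using that E by (auto simp: A_def)
    then have "f x \<le> d" "f y > d"
      using bij_betwE[OF fA] bij_betwE[OF fB] bij_betwE[OF fC] S(1) by fastforce+
    then show ?thesis
      by simp
  qed
  have core_notin_B: "{Core i, Core j} \<notin> B" for i j
    by (auto simp: B_def doubleton_eq_iff)
  have pend_in_B: "{Core i, Pendant i j} \<in> B" if "i \<in> {1..<m}" "j \<in> {1..n i}" for i j
    using that by (auto simp: B_def)
  \<comment> \<open>If \<open>b = m\<close>, the compared edges at \<open>b\<close> lie in
    \<open>A\<close> and those at \<open>a\<close> do not, so \<open>low\<close> decides. If
    \<open>b < m\<close>, compared edges lie in the same class, even when \<open>c = m\<close>, and
    their keys favour \<open>a\<close>.\<close>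
  have less: "vertex_sum ?E f (Core b) < vertex_sum ?E f (Core a)"
    if ab: "a \<in> {1..m}" "b \<in> {1..m}" "a < b" for a b
  proof (rule vertex_sum_Core_less)
    show "n b \<le> n a"
      using ab antimono by auto
    show "m \<ge> 3 \<or> n b \<ge> 1"
      using ab not_star by (cases "b = m") auto
    fix c assume c: "c \<in> {1..m} - {a, b}"
    have E': "{Core b, Core c} \<in> ?E" "{Core a, Core c} \<in> ?E"
      using ab c by (auto intro: Core_edge_in)
    show "f {Core b, Core c} < f {Core a, Core c}"
    proof (cases "b = m")
      case True
      then show ?thesis
        using ab c by (intro low E') auto
    next
      case False
      then show ?thesis
        using ab c edge_key_Core_less[of a b m c] core_notin_B by (intro mono E') auto
    qed
  next
    fix j assume j: "j \<in> {1..n b}"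
    have ja: "j \<in> {1..n a}"
      using j antimono[of a b] ab by auto
    have E': "{Core b, Pendant b j} \<in> ?E" "{Core a, Pendant a j} \<in> ?E"
      using ab j ja by (auto intro: Pendant_edge_in)
    show "f {Core b, Pendant b j} < f {Core a, Pendant a j}"
    proof (cases "b = m")
      case True
      then show ?thesis
        using ab by (intro low E') auto
    next
      case False
      then have "{Core b, Pendant b j} \<in> B" "{Core a, Pendant a j} \<in> B"
        using ab j ja by (auto intro: pend_in_B)
      then show ?thesis
        using False ab edge_key_Pendant_less[of a b m j] by (intro mono E') auto
    qed
  qed (use ab in auto)
  have "vertex_sum ?E f u \<noteq> vertex_sum ?E f v"
    if "u \<in> K_verts m n" "v \<in> K_verts m n" "{u, v} \<in> ?E" for u v
  proof -
    \<comment> \<open>An edge between cores is oriented with \<open>i < j\<close>, so that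
      \<open>less\<close> applies.\<close>
    from that(3) consider
        i j where "{u, v} = {Core i, Core j}" "i \<in> {1..m}" "j \<in> {1..m}" "i < j"
      | i j where "{u, v} = {Core i, Pendant i j}" "i \<in> {1..m}" "j \<in> {1..n i}"
      unfolding K_edges_def by (force simp: doubleton_eq_iff neq_iff)
    then show ?thesis
    proof cases
      case 1
      then show ?thesis
        using less[of i j] by (auto simp: doubleton_eq_iff)
    next
      case 2
      then show ?thesis
        using Pendant_less_Core[OF m, of i j n f] pos by (auto simp: doubleton_eq_iff)
    qed
  qed
  then have "local_antimagic_labeling (K_verts m n) ?E f"
    using bij by (simp add: local_antimagic_labeling_def)
  moreover have "vertex_sum ?E f (Core m) = \<Sum>{1..d}"
    unfolding vertex_sum_def using sum.reindex_bij_betw[OF fA, of "\<lambda>x. x"] by (simp add: A_def)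
  moreover have "\<exists>i\<in>{1..m}. \<exists>j\<in>{1..n i}. f {Core i, Pendant i j} = L"
  proof -
    have "L \<in> f ` B"
      using fB S(4) by (simp add: bij_betw_def)
    then obtain i j where "i \<in> {1..<m}" "j \<in> {1..n i}" "f {Core i, Pendant i j} = L"
      by (auto simp: B_def)
    then show ?thesis
      by (intro bexI[of _ i] bexI[of _ j]) auto
  qed
  ultimately show ?thesis
    unfolding d_def by blast
qed

section \<open>The chromatic number\<close>

lemma chi_la_le:
  assumes "local_antimagic_labeling V E f"
  shows "chi_la V E \<le> enat (color_number V E f)"
  unfolding chi_la_def using assms by (intro INF_lower) simp

text \<open>The labeling \<open>f\<close> rules out the value infinity, which the infimum takes over
  an empty set.\<close>

lemma chi_la_eqI:
  assumes "local_antimagic_labeling V E f"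
    and "\<And>g. local_antimagic_labeling V E g \<Longrightarrow> color_number V E g = k"
  shows "chi_la V E = enat k"
  using chi_la_le[OF assms(1)] assms
  by (intro antisym) (auto simp: chi_la_def intro: INF_greatest)

text \<open>The graph is a star centred at core 1, with core 2 as one more leaf. Leaf sums are
  single labels, hence distinct, and the centre is adjacent to every leaf, so every local antimagic
  labeling has pairwise distinct vertex sums.\<close>

lemma chi_la_star:
  assumes n: "n 1 \<ge> 1" "n 2 = 0"
  shows "chi_la (K_verts 2 n) (K_edges 2 n) = enat (n 1 + 2)"
proof -
  let ?E = "K_edges 2 n"
  have two: "{1..2} = {1, 2 :: nat}"
    by auto
  have "{Core 1, Core 2} \<in> ?E"
    by (intro Core_edge_in) auto
  have "{1..2} - {2} = {1 :: nat}"
    by auto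
  then have w2: "vertex_sum ?E f (Core 2) = f {Core 1, Core 2}" for f
    using n vertex_sum_Core[of 2 2 n f] by (simp add: insert_commute)
  have color: "color_number (K_verts 2 n) ?E g = n 1 + 2"
    if g: "local_antimagic_labeling (K_verts 2 n) ?E g" for g
  proof -
    have inj: "inj_on g ?E"
      using g by (simp add: local_antimagic_labeling_def bij_betw_def)
    have "vertex_sum ?E g (Core k) \<noteq> vertex_sum ?E g (Pendant i j)"
      if kij: "k \<in> {1..2}" "i \<in> {1..2}" "j \<in> {1..n i}" for k i j
    proof -
      have i: "i = 1"
        using kij n by (cases "i = 2") auto
      have e: "{Core 1, Pendant 1 j} \<in> ?E"
        using kij i by (intro Pendant_edge_in) auto
      show ?thesis
      proof (cases "k = 1")
        case True
        have "Core 1 \<in> K_verts 2 n" "Pendant 1 j \<in> K_verts 2 n"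
          using kij i by (auto simp: K_verts_def)
        then show ?thesis
          using g e True i unfolding local_antimagic_labeling_def by blast
      next
        case False
        then have "k = 2"
          using kij by auto
        moreover have "g {Core 1, Core 2} \<noteq> g {Core 1, Pendant 1 j}"
          using inj e \<open>{Core 1, Core 2} \<in> ?E\<close> by (auto simp: inj_on_def doubleton_eq_iff)
        ultimately show ?thesis
          using w2 vertex_sum_Pendant[of 1 2 j n g] kij i by simp
      qed
    qed
    then show ?thesis
      using color_number_maximal[OF g] n unfolding two by simp
  qed
  \<comment> \<open>Any bijection will do: the centre has at least two edges, so its sum exceeds the
    label of each leaf.\<close>
  obtain f where f: "bij_betw f ?E {1..card ?E}"
    using finite_same_card_bij[of ?E "{1..card ?E}"] finite_K_edges by auto
  have pos: "f e > 0" if "e \<in> ?E" for e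
    using bij_betwE[OF f] that by fastforce
  have w12: "vertex_sum ?E f (Core 2) < vertex_sum ?E f (Core 1)"
    unfolding w2
    using n \<open>{Core 1, Core 2} \<in> ?E\<close>
    by (intro label_less_vertex_sum[where e' = "{Core 1, Pendant 1 1}"])
      (auto intro!: finite_K_edges Pendant_edge_in pos simp: doubleton_eq_iff)
  have "vertex_sum ?E f u \<noteq> vertex_sum ?E f v" if "{u, v} \<in> ?E" for u v
  proof -
    from that consider "{u, v} = {Core 1, Core 2}"
      | i j where "{u, v} = {Core i, Pendant i j}" "i \<in> {1..2}" "j \<in> {1..n i}"
      unfolding K_edges_def two by (force simp: doubleton_eq_iff)
    then show ?thesis
    proof cases
      case 1
      then show ?thesis
        using w12 by (auto simp: doubleton_eq_iff)
    next
      case 2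
      then show ?thesis
        using Pendant_less_Core[of 2 i j n f] pos by (auto simp: doubleton_eq_iff)
    qed
  qed
  then have "local_antimagic_labeling (K_verts 2 n) ?E f"
    using f by (simp add: local_antimagic_labeling_def)
  then show ?thesis
    using color by (rule chi_la_eqI)
qed

theorem theorem3p1:
  fixes m :: nat and n :: "nat \<Rightarrow> nat"
  assumes "m \<ge> 2"
    and "\<And>i j. 1 \<le> i \<Longrightarrow> i \<le> j \<Longrightarrow> j \<le> m \<Longrightarrow> n j \<le> n i"
    and "(\<Sum>i=1..m. n i) \<ge> 1"
  shows "if m = 2 \<and> n 2 = 0
         then chi_la (K_verts m n) (K_edges m n) = enat (n 1 + 2)
         else chi_la (K_verts m n) (K_edges m n) \<le> enat ((\<Sum>i=1..m. n i) + m) \<and>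
              (chi_la (K_verts m n) (K_edges m n) = enat ((\<Sum>i=1..m. n i) + m) \<longleftrightarrow>
               (real (n m) + real m - 1) * (real (n m) + real m) / 2
                 > (\<Sum>i=1..m. real (n i)) + real (m choose 2))"
proof -
  let ?V = "K_verts m n" and ?E = "K_edges m n" and ?N = "(\<Sum>i=1..m. n i) + m"
  define d where "d = n m + m - 1"
  have n1: "n 1 \<ge> 1"
  proof (rule ccontr)
    assume "\<not> n 1 \<ge> 1"
    then have "n i = 0" if "i \<in> {1..m}" for i
      using assms(2)[of 1 i] that by auto
    then show False
      using assms(3) by simp
  qed
  have main: "chi_la ?V ?E \<le> enat ?N \<and> (chi_la ?V ?E = enat ?N \<longleftrightarrow> card ?E < \<Sum>{1..d})"
    if not_star: "\<not> (m = 2 \<and> n 2 = 0)"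
  proof -
    have ns: "m \<ge> 3 \<or> n m \<ge> 1"
      using not_star assms(1) by (cases "m = 2") auto
    \<comment> \<open>A pendant edge at core 1 avoids core \<open>m\<close>, so the \<open>d\<close>
      edges at core \<open>m\<close> are not all edges.\<close>
    have "card (insert {Core 1, Pendant 1 1} {e \<in> ?E. Core m \<in> e}) \<le> card ?E"
      using assms(1) n1 by (intro card_mono finite_K_edges) (auto intro: Pendant_edge_in)
    then have dE: "d < card ?E"
      using assms(1) finite_K_edges[of m n] card_edges_at_Core[of m m n]
      by (simp add: card_insert_if d_def)
    \<comment> \<open>Only the existence of a labeling matters here; the largest label is an
      admissible \<open>L\<close>.\<close>
    obtain f where f: "local_antimagic_labeling ?V ?E f"
      using ex_labeling[of m n "card ?E"] assms n1 ns dE unfolding d_def by blast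
    have le: "chi_la ?V ?E \<le> enat ?N"
      using chi_la_le[OF f] color_number_le_card[of m n f] by (meson enat_ord_simps(1) order_trans)
    have "chi_la ?V ?E = enat ?N" if "card ?E < \<Sum>{1..d}"
      using f
    proof (rule chi_la_eqI)
      fix g assume "local_antimagic_labeling ?V ?E g"
      then show "color_number ?V ?E g = ?N"
        using that assms(2) by (intro color_number_eq_of_large_degrees) (auto simp: d_def)
    qed
    moreover have "chi_la ?V ?E \<noteq> enat ?N" if small: "\<Sum>{1..d} \<le> card ?E"
    proof -
      \<comment> \<open>Excluding the star gives \<open>d >= 2\<close>, exactly the condition under
        which the triangular number exceeds \<open>d\<close> and can serve as
        \<open>L\<close>.\<close>
      have "d \<ge> 2"
        using ns assms(1) by (auto simp: d_def)
      then have "sum (\<lambda>x. x) {1, d} \<le> \<Sum>{1..d}"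
        by (intro sum_mono2) auto
      then have "d < \<Sum>{1..d}"
        using \<open>d \<ge> 2\<close> by simp
      then obtain g i j where g: "local_antimagic_labeling ?V ?E g"
        "vertex_sum ?E g (Core m) = \<Sum>{1..d}"
        "i \<in> {1..m}" "j \<in> {1..n i}" "g {Core i, Pendant i j} = \<Sum>{1..d}"
        using ex_labeling[of m n "\<Sum>{1..d}"] assms n1 ns small unfolding d_def by blast
      then have "vertex_sum ?E g (Core m) = vertex_sum ?E g (Pendant i j)"
        by (simp add: vertex_sum_Pendant)
      moreover have "Core m \<in> ?V" "Pendant i j \<in> ?V"
        using g assms(1) by (auto simp: K_verts_def)
      \<comment> \<open>Two vertices with one color leave fewer colors than vertices.\<close>
      ultimately have "\<not> inj_on (vertex_sum ?E g) ?V"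
        by (auto simp: inj_on_def)
      then have "color_number ?V ?E g \<noteq> ?N"
        unfolding color_number_def card_K_verts[symmetric]
        using eq_card_imp_inj_on[OF finite_K_verts] by metis
      then have "enat (color_number ?V ?E g) < enat ?N"
        using color_number_le_card[of m n g] by simp
      then show ?thesis
        using chi_la_le[OF g(1)] by auto
    qed
    ultimately show ?thesis
      using le by (auto simp: not_less[symmetric])
  qed
  have "2 * real (\<Sum>{1..d}) = real d * (real d + 1)"
    by (induction d) (auto simp: algebra_simps)
  \<comment> \<open>Since \<open>m >= 2\<close>, the truncated subtraction in \<open>d\<close>
    agrees with the real one.\<close>
  moreover have "real d = real (n m) + real m - 1"
    using assms(1) by (simp add: d_def)
  ultimately have "(real (n m) + real m - 1) * (real (n m) + real m) / 2 = real (\<Sum>{1..d})"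
    by simp
  moreover have "(\<Sum>i=1..m. real (n i)) + real (m choose 2) = real (card ?E)"
    by (simp add: card_K_edges)
  ultimately show ?thesis
    using main chi_la_star[of n] n1 by (auto simp del: of_nat_sum)
qed

end
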